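(* There is a closed, well-formed term $u$ such that $\emptyset\vdash u\cdot\underline n$ is derivable in OGA for every $n\in\mathbb N$, while $\emptyset\vdash\mathcal A\cdot u$ is not derivable in OGA.
   Context: **Syntax.** Terms: $t::=v_i\mid\bot\mid\mathbf 0\mid\mathbf S t\mid t=t\mid\neg t\mid t\lor t\mid\lambda t\mid t\cdot t\mid\mathcal R\mid\mathcal A$ ($v_i$, $i\in\mathbb N$, de Bruijn variables; $\lambda$ is the only binder; application associates to the left). A term is well-formed (wf) if generated by this grammar. $\bot$ is a divergent constant, $\mathcal R$ the primitive recursor, $\mathcal A$ the universal quantifier. Abbreviations: $t\,\mathsf N$ is $t=t$; $t\,\mathsf B$ is $t\lor\neg t$; $t\ne u$ is $\neg(t=u)$; $t\land u$ is $\neg(\neg t\lor\neg u)$; $t\to u$ is $\neg t\lor u$; $\underline n=\mathbf S^n\mathbf 0$. $\uparrow$ shifts all free indices up by one; $b[t]$ is the $\beta$-instance substituting $t$ for the outermost bound variable of $b$; $[v\mapsto s]$ is capture-avoiding substitution for a free variable; $\mathrm{fv}$ is the set of free variables. **Head steps** $\triangleright$: $(\lambda b)\cdot t\triangleright b[t]$; $\mathcal R\cdot g\cdot h\cdot\mathbf 0\triangleright g$; $\mathcal R\cdot g\cdot h\cdot(\mathbf S\underline n)\triangleright h\cdot\underline n\cdot(\mathcal R\cdot g\cdot h\cdot\underline n)$; if $t\triangleright t'$ then $t\cdot u\triangleright t'\cdot u$. **Rules.** Judgments are $\Gamma\vdash c$, $\Gamma$ a finite set of wf terms, $c$ a wf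 term (all terms in rules are wf). A proof is a finite list of judgments each following from earlier entries by one rule; $\Gamma\vdash c$ is derivable if it occurs in a proof. Rules ("$\Rightarrow$" from premises to conclusion, "$\Leftrightarrow$" both directions; $\Gamma$ is the context of a judgment when none is shown): $\Gamma,c\vdash c$; $\Gamma\vdash c\Rightarrow\Gamma,a\vdash c$; $\Gamma\vdash a$ and $\Gamma,a\vdash c\Rightarrow\Gamma\vdash c$; $\Gamma\vdash c\Rightarrow[v\mapsto s]\Gamma\vdash[v\mapsto s]c$; $\vdash a\Leftrightarrow\ \vdash a=\underline1$; $\vdash\neg a\Leftrightarrow\ \vdash a=\underline0$; $\vdash\neg a,\ \vdash a\Rightarrow\ \vdash c$; $\vdash a\Leftrightarrow\ \vdash\neg\neg a$; $\vdash a\Rightarrow\ \vdash a\lor b$; $\vdash b\Rightarrow\ \vdash a\lor b$; $\vdash\neg a,\ \vdash\neg b\Rightarrow\ \vdash\neg(a\lor b)$; $\vdash a\lor b,\ \Gamma,a\vdash c,\ \Gamma,b\vdash c\Rightarrow\ \vdash c$; $\vdash\neg(a\lor b)\Rightarrow\ \vdash\neg a$; $\vdash\neg(a\lor b)\Rightarrow\ \vdash\neg b$; $\vdash a\,\mathsf N\Leftrightarrow\ \vdash a=a$; $\vdash a=b\Rightarrow\ \vdash b=a$; $\vdash a=b,\ \vdash[v\mapsto a]p\Rightarrow\ \vdash[v\mapsto b]p$; $\vdash a\ne b\Rightarrow\ \vdash b\ne a$; $\vdash a\,\mathsf N,\ \vdash b\,\mathsf N\Rightarrow\ \vdash(a=b)\,\mathsf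 B$; $\vdash(a=b)\,\mathsf B\Rightarrow\ \vdash(a\,\mathsf N)\land(b\,\mathsf N)$; $\vdash\mathbf 0\,\mathsf N$; $\vdash a\,\mathsf N\Leftrightarrow\ \vdash(\mathbf S a)\,\mathsf N$; $\vdash a\,\mathsf N\Rightarrow\ \vdash\mathbf S a\ne\mathbf 0$; $\vdash a\ne b\Leftrightarrow\ \vdash\mathbf S a\ne\mathbf S b$; $\vdash\mathbf S a=\mathbf S b\Rightarrow\ \vdash a=b$; $\vdash\bot\,\mathsf N\Rightarrow\ \vdash p$; induction: $\vdash[v_i\mapsto\mathbf 0]c$, $\ v_i\,\mathsf N,c,\Gamma\vdash[v_i\mapsto\mathbf S v_i]c$, $\ \vdash a\,\mathsf N\Rightarrow\ \vdash[v_i\mapsto a]c$ if $v_i\notin\mathrm{fv}(\Gamma)$; conversion, for $c\triangleright c'$: $\vdash c'\Rightarrow\ \vdash c$; $\vdash c\Rightarrow\ \vdash c'$; $\vdash\neg c\Rightarrow\ \vdash\neg c'$; $\vdash c'\,\mathsf N\Rightarrow\ \vdash c=c'$; $\vdash m\,\mathsf N,\ \vdash(h\cdot m\cdot(\mathcal R\cdot g\cdot h\cdot m))\,\mathsf N\Rightarrow\ \vdash\mathcal R\cdot g\cdot h\cdot(\mathbf S m)=h\cdot m\cdot(\mathcal R\cdot g\cdot h\cdot m)$; $v_0\,\mathsf N,\uparrow\Gamma\vdash\uparrow f\cdot v_0\Rightarrow\Gamma\vdash\mathcal A\cdot f$; $\vdash\mathcal A\cdot f,\ \vdash a\,\mathsf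 N\Rightarrow\ \vdash f\cdot a$; $\vdash\neg(f\cdot a),\ \vdash a\,\mathsf N\Rightarrow\ \vdash\neg(\mathcal A\cdot f)$; $\Gamma\vdash\neg(\mathcal A\cdot f)$ and $v_0\,\mathsf N,\neg(\uparrow f\cdot v_0),\uparrow\Gamma\vdash\uparrow c\Rightarrow\Gamma\vdash c$. These are the rules of RGA. OGA has these and the rule ATI: $\Gamma\vdash\mathcal A\cdot(\lambda((\uparrow u\cdot v_0)\,\mathsf B))\Rightarrow\Gamma\vdash(\mathcal A\cdot u)\,\mathsf B$. *)

theory Defs
  imports Main "HOL-Library.FSet"
begin

text \<open>The values of the following datatype are exactly the terms generated by the grammar, so
  well-formedness of a term is carried by its type.\<close>

datatype trm =
    Var nat
  | Bot
  | Zero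
  | Succ trm
  | Eq trm trm  (infix "\<^bold>=" 70)
  | Neg trm  ("\<^bold>\<not> _" [85] 85)
  | Or trm trm  (infixr "\<^bold>\<or>" 65)
  | Lam trm
  | App trm trm  (infixl "\<cdot>" 100)
  | Rec
  | Univ

abbreviation Nat_trm :: "trm \<Rightarrow> trm"  ("_ \<^bold>N" [90] 90)
  where "t \<^bold>N \<equiv> (t \<^bold>= t)"

abbreviation Bool_trm :: "trm \<Rightarrow> trm"  ("_ \<^bold>B" [90] 90)
  where "t \<^bold>B \<equiv> (t \<^bold>\<or> \<^bold>\<not> t)"

abbreviation Neq :: "trm \<Rightarrow> trm \<Rightarrow> trm"  (infix "\<^bold>\<noteq>" 70)
  where "t \<^bold>\<noteq> u \<equiv> \<^bold>\<not> (t \<^bold>= u)"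

abbreviation And :: "trm \<Rightarrow> trm \<Rightarrow> trm"  (infixr "\<^bold>\<and>" 66)
  where "t \<^bold>\<and> u \<equiv> \<^bold>\<not> (\<^bold>\<not> t \<^bold>\<or> \<^bold>\<not> u)"

definition numl :: "nat \<Rightarrow> trm"
  where "numl n = (Succ ^^ n) Zero"

fun fv :: "trm \<Rightarrow> nat set" where
  "fv (Var i) = {i}"
| "fv Bot = {}"
| "fv Zero = {}"
| "fv (Succ t) = fv t"
| "fv (t \<^bold>= u) = fv t \<union> fv u"
| "fv (\<^bold>\<not> t) = fv t"
| "fv (t \<^bold>\<or> u) = fv t \<union> fv u"
| "fv (Lam b) = {i. Suc i \<in> fv b}"
| "fv (t \<cdot> u) = fv t \<union> fv u"
| "fv Rec = {}"
| "fv Univ = {}"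

text \<open>Shift by one of the indices that are at least the cutoff \<open>k\<close>.\<close>

fun shift :: "nat \<Rightarrow> trm \<Rightarrow> trm" where
  "shift k (Var i) = Var (if i < k then i else Suc i)"
| "shift k Bot = Bot"
| "shift k Zero = Zero"
| "shift k (Succ t) = Succ (shift k t)"
| "shift k (t \<^bold>= u) = (shift k t \<^bold>= shift k u)"
| "shift k (\<^bold>\<not> t) = \<^bold>\<not> shift k t"
| "shift k (t \<^bold>\<or> u) = (shift k t \<^bold>\<or> shift k u)"
| "shift k (Lam b) = Lam (shift (Suc k) b)"
| "shift k (t \<cdot> u) = shift k t \<cdot> shift k u"
| "shift k Rec = Rec"
| "shift k Univ = Univ"

abbreviation up :: "trm \<Rightarrow> trm"  ("\<up> _" [110] 110)
  where "\<up> t \<equiv> shift 0 t"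

text \<open>Substitution for the free variable \<open>v\<^sub>i\<close>; all other free variables keep their index.\<close>

fun subst :: "nat \<Rightarrow> trm \<Rightarrow> trm \<Rightarrow> trm"  ("[_ \<^bold>\<mapsto> _] _" [0, 0, 110] 110) where
  "[i \<^bold>\<mapsto> s] (Var j) = (if j = i then s else Var j)"
| "[i \<^bold>\<mapsto> s] Bot = Bot"
| "[i \<^bold>\<mapsto> s] Zero = Zero"
| "[i \<^bold>\<mapsto> s] (Succ t) = Succ ([i \<^bold>\<mapsto> s] t)"
| "[i \<^bold>\<mapsto> s] (t \<^bold>= u) = ([i \<^bold>\<mapsto> s] t \<^bold>= [i \<^bold>\<mapsto> s] u)"
| "[i \<^bold>\<mapsto> s] (\<^bold>\<not> t) = \<^bold>\<not> [i \<^bold>\<mapsto> s] t"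
| "[i \<^bold>\<mapsto> s] (t \<^bold>\<or> u) = ([i \<^bold>\<mapsto> s] t \<^bold>\<or> [i \<^bold>\<mapsto> s] u)"
| "[i \<^bold>\<mapsto> s] (Lam b) = Lam ([Suc i \<^bold>\<mapsto> \<up> s] b)"
| "[i \<^bold>\<mapsto> s] (t \<cdot> u) = [i \<^bold>\<mapsto> s] t \<cdot> [i \<^bold>\<mapsto> s] u"
| "[i \<^bold>\<mapsto> s] Rec = Rec"
| "[i \<^bold>\<mapsto> s] Univ = Univ"

text \<open>\<open>inst k s b\<close> substitutes \<open>s\<close> for the variable of index \<open>k\<close> and removes that variable, lowering
  all larger indices by one; the \<open>\<beta>\<close>-instance \<open>b[s]\<close> is \<open>inst 0 s b\<close>.\<close>

fun inst :: "nat \<Rightarrow> trm \<Rightarrow> trm \<Rightarrow> trm" where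
  "inst k s (Var i) = (if i < k then Var i else if i = k then s else Var (i - 1))"
| "inst k s Bot = Bot"
| "inst k s Zero = Zero"
| "inst k s (Succ t) = Succ (inst k s t)"
| "inst k s (t \<^bold>= u) = (inst k s t \<^bold>= inst k s u)"
| "inst k s (\<^bold>\<not> t) = \<^bold>\<not> inst k s t"
| "inst k s (t \<^bold>\<or> u) = (inst k s t \<^bold>\<or> inst k s u)"
| "inst k s (Lam b) = Lam (inst (Suc k) (\<up> s) b)"
| "inst k s (t \<cdot> u) = inst k s t \<cdot> inst k s u"
| "inst k s Rec = Rec"
| "inst k s Univ = Univ"

inductive head_step :: "trm \<Rightarrow> trm \<Rightarrow> bool"  (infix "\<triangleright>" 50) where
  beta: "Lam b \<cdot> t \<triangleright> inst 0 t b"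
| rec_0: "Rec \<cdot> g \<cdot> h \<cdot> Zero \<triangleright> g"
| rec_S: "Rec \<cdot> g \<cdot> h \<cdot> Succ (numl n) \<triangleright> h \<cdot> numl n \<cdot> (Rec \<cdot> g \<cdot> h \<cdot> numl n)"
| app: "t \<triangleright> t' \<Longrightarrow> t \<cdot> u \<triangleright> t' \<cdot> u"

datatype sequent = Sequent "trm fset" trm  (infix "\<turnstile>" 55)

abbreviation ctx_ins :: "trm fset \<Rightarrow> trm \<Rightarrow> trm fset"  (infixl "\<^bold>," 56)
  where "\<Gamma> \<^bold>, a \<equiv> finsert a \<Gamma>"

text \<open>\<open>rga_rule Ps J\<close>: the sequent \<open>J\<close> follows from the premises \<open>Ps\<close> by one rule.\<close>

inductive rga_rule :: "sequent list \<Rightarrow> sequent \<Rightarrow> bool" where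
  hyp: "rga_rule [] (\<Gamma> \<^bold>, c \<turnstile> c)"
| weaken: "rga_rule [\<Gamma> \<turnstile> c] (\<Gamma> \<^bold>, a \<turnstile> c)"
| cut: "rga_rule [\<Gamma> \<turnstile> a, \<Gamma> \<^bold>, a \<turnstile> c] (\<Gamma> \<turnstile> c)"
| subst: "rga_rule [\<Gamma> \<turnstile> c] (fimage (subst i s) \<Gamma> \<turnstile> [i \<^bold>\<mapsto> s] c)"

| true_eqI: "rga_rule [\<Gamma> \<turnstile> a] (\<Gamma> \<turnstile> a \<^bold>= numl 1)"
| true_eqE: "rga_rule [\<Gamma> \<turnstile> a \<^bold>= numl 1] (\<Gamma> \<turnstile> a)"
| false_eqI: "rga_rule [\<Gamma> \<turnstile> \<^bold>\<not> a] (\<Gamma> \<turnstile> a \<^bold>= numl 0)"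
| false_eqE: "rga_rule [\<Gamma> \<turnstile> a \<^bold>= numl 0] (\<Gamma> \<turnstile> \<^bold>\<not> a)"

| negE: "rga_rule [\<Gamma> \<turnstile> \<^bold>\<not> a, \<Gamma> \<turnstile> a] (\<Gamma> \<turnstile> c)"
| neg_negI: "rga_rule [\<Gamma> \<turnstile> a] (\<Gamma> \<turnstile> \<^bold>\<not> \<^bold>\<not> a)"
| neg_negE: "rga_rule [\<Gamma> \<turnstile> \<^bold>\<not> \<^bold>\<not> a] (\<Gamma> \<turnstile> a)"

| orI1: "rga_rule [\<Gamma> \<turnstile> a] (\<Gamma> \<turnstile> a \<^bold>\<or> b)"
| orI2: "rga_rule [\<Gamma> \<turnstile> b] (\<Gamma> \<turnstile> a \<^bold>\<or> b)"
| neg_orI: "rga_rule [\<Gamma> \<turnstile> \<^bold>\<not> a, \<Gamma> \<turnstile> \<^bold>\<not> b] (\<Gamma> \<turnstile> \<^bold>\<not> (a \<^bold>\<or> b))"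
| orE: "rga_rule [\<Gamma> \<turnstile> a \<^bold>\<or> b, \<Gamma> \<^bold>, a \<turnstile> c, \<Gamma> \<^bold>, b \<turnstile> c] (\<Gamma> \<turnstile> c)"
| neg_orE1: "rga_rule [\<Gamma> \<turnstile> \<^bold>\<not> (a \<^bold>\<or> b)] (\<Gamma> \<turnstile> \<^bold>\<not> a)"
| neg_orE2: "rga_rule [\<Gamma> \<turnstile> \<^bold>\<not> (a \<^bold>\<or> b)] (\<Gamma> \<turnstile> \<^bold>\<not> b)"

\<comment> \<open>These two are trivial, \<open>a \<^bold>N\<close> being an abbreviation of \<open>a \<^bold>= a\<close>.\<close>
| nat_eqD: "rga_rule [\<Gamma> \<turnstile> a \<^bold>N] (\<Gamma> \<turnstile> a \<^bold>= a)"
| nat_eqI: "rga_rule [\<Gamma> \<turnstile> a \<^bold>= a] (\<Gamma> \<turnstile> a \<^bold>N)"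
| eq_sym: "rga_rule [\<Gamma> \<turnstile> a \<^bold>= b] (\<Gamma> \<turnstile> b \<^bold>= a)"
| eq_subst: "rga_rule [\<Gamma> \<turnstile> a \<^bold>= b, \<Gamma> \<turnstile> [i \<^bold>\<mapsto> a] p] (\<Gamma> \<turnstile> [i \<^bold>\<mapsto> b] p)"
| neq_sym: "rga_rule [\<Gamma> \<turnstile> a \<^bold>\<noteq> b] (\<Gamma> \<turnstile> b \<^bold>\<noteq> a)"
| eq_boolI: "rga_rule [\<Gamma> \<turnstile> a \<^bold>N, \<Gamma> \<turnstile> b \<^bold>N] (\<Gamma> \<turnstile> (a \<^bold>= b) \<^bold>B)"
| eq_boolE: "rga_rule [\<Gamma> \<turnstile> (a \<^bold>= b) \<^bold>B] (\<Gamma> \<turnstile> a \<^bold>N \<^bold>\<and> b \<^bold>N)"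

| zero_nat: "rga_rule [] (\<Gamma> \<turnstile> Zero \<^bold>N)"
| succ_natI: "rga_rule [\<Gamma> \<turnstile> a \<^bold>N] (\<Gamma> \<turnstile> (Succ a) \<^bold>N)"
| succ_natE: "rga_rule [\<Gamma> \<turnstile> (Succ a) \<^bold>N] (\<Gamma> \<turnstile> a \<^bold>N)"
| succ_neq_zero: "rga_rule [\<Gamma> \<turnstile> a \<^bold>N] (\<Gamma> \<turnstile> Succ a \<^bold>\<noteq> Zero)"
| succ_neqI: "rga_rule [\<Gamma> \<turnstile> a \<^bold>\<noteq> b] (\<Gamma> \<turnstile> Succ a \<^bold>\<noteq> Succ b)"
| succ_neqE: "rga_rule [\<Gamma> \<turnstile> Succ a \<^bold>\<noteq> Succ b] (\<Gamma> \<turnstile> a \<^bold>\<noteq> b)"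
| succ_inj: "rga_rule [\<Gamma> \<turnstile> Succ a \<^bold>= Succ b] (\<Gamma> \<turnstile> a \<^bold>= b)"
| bot: "rga_rule [\<Gamma> \<turnstile> Bot \<^bold>N] (\<Gamma> \<turnstile> p)"

| induction: "(\<And>t. t |\<in>| \<Gamma> \<Longrightarrow> i \<notin> fv t) \<Longrightarrow>
    rga_rule
      [\<Gamma> \<turnstile> [i \<^bold>\<mapsto> Zero] c,
       \<Gamma> \<^bold>, c \<^bold>, (Var i) \<^bold>N \<turnstile> [i \<^bold>\<mapsto> Succ (Var i)] c,
       \<Gamma> \<turnstile> a \<^bold>N]
      (\<Gamma> \<turnstile> [i \<^bold>\<mapsto> a] c)"

| conv_exp: "c \<triangleright> c' \<Longrightarrow> rga_rule [\<Gamma> \<turnstile> c'] (\<Gamma> \<turnstile> c)"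
| conv_red: "c \<triangleright> c' \<Longrightarrow> rga_rule [\<Gamma> \<turnstile> c] (\<Gamma> \<turnstile> c')"
| conv_neg: "c \<triangleright> c' \<Longrightarrow> rga_rule [\<Gamma> \<turnstile> \<^bold>\<not> c] (\<Gamma> \<turnstile> \<^bold>\<not> c')"
| conv_eq: "c \<triangleright> c' \<Longrightarrow> rga_rule [\<Gamma> \<turnstile> c' \<^bold>N] (\<Gamma> \<turnstile> c \<^bold>= c')"

| rec_eq: "rga_rule
      [\<Gamma> \<turnstile> m \<^bold>N, \<Gamma> \<turnstile> (h \<cdot> m \<cdot> (Rec \<cdot> g \<cdot> h \<cdot> m)) \<^bold>N]
      (\<Gamma> \<turnstile> Rec \<cdot> g \<cdot> h \<cdot> Succ m \<^bold>= h \<cdot> m \<cdot> (Rec \<cdot> g \<cdot> h \<cdot> m))"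

| univI: "rga_rule [fimage (shift 0) \<Gamma> \<^bold>, (Var 0) \<^bold>N \<turnstile> \<up> f \<cdot> Var 0] (\<Gamma> \<turnstile> Univ \<cdot> f)"
| univE: "rga_rule [\<Gamma> \<turnstile> Univ \<cdot> f, \<Gamma> \<turnstile> a \<^bold>N] (\<Gamma> \<turnstile> f \<cdot> a)"
| neg_univI: "rga_rule [\<Gamma> \<turnstile> \<^bold>\<not> (f \<cdot> a), \<Gamma> \<turnstile> a \<^bold>N] (\<Gamma> \<turnstile> \<^bold>\<not> (Univ \<cdot> f))"
| neg_univE: "rga_rule
      [\<Gamma> \<turnstile> \<^bold>\<not> (Univ \<cdot> f),
       fimage (shift 0) \<Gamma> \<^bold>, \<^bold>\<not> (\<up> f \<cdot> Var 0) \<^bold>, (Var 0) \<^bold>N \<turnstile> \<up> c]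
      (\<Gamma> \<turnstile> c)"

inductive oga_rule :: "sequent list \<Rightarrow> sequent \<Rightarrow> bool" where
  rga: "rga_rule Ps J \<Longrightarrow> oga_rule Ps J"
| ati: "oga_rule [\<Gamma> \<turnstile> Univ \<cdot> Lam ((\<up> u \<cdot> Var 0) \<^bold>B)] (\<Gamma> \<turnstile> (Univ \<cdot> u) \<^bold>B)"

definition is_proof :: "(sequent list \<Rightarrow> sequent \<Rightarrow> bool) \<Rightarrow> sequent list \<Rightarrow> bool" where
  "is_proof R Js \<longleftrightarrow>
    (\<forall>k < length Js. \<exists>Ps. set Ps \<subseteq> set (take k Js) \<and> R Ps (Js ! k))"

definition derivable :: "(sequent list \<Rightarrow> sequent \<Rightarrow> bool) \<Rightarrow> sequent \<Rightarrow> bool" where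
  "derivable R J \<longleftrightarrow> (\<exists>Js. is_proof R Js \<and> J \<in> set Js)"

end

theory Submission
  imports Defs "HOL-Library.Countable_Set_Type" "HOL-Library.Multiset"
begin

text \<open>The term \<open>u\<close> recurses on a function: \<open>u \<cdot> n\<close> unfolds \<open>n\<close> times a recursion that leaves the
  constant function \<open>1\<close> unchanged. The head steps of the recursor unfold it for numerals, but the
  rule \<open>rec_eq\<close>, the only one that concerns other arguments, needs the value of the recursion
  to be a number. So for each \<open>K\<close> there is a model in which a recursion is unfolded without
  restriction only up to step \<open>K\<close>, and beyond it retains only numbers. A proof uses finitely many
  head steps, hence is sound in this model for all large \<open>K\<close>, whereas \<open>u \<cdot> (K + 1)\<close> is
  undefined there, and \<open>Univ \<cdot> u\<close> does not hold.

  The models are graph models of the untyped \<open>\<lambda>\<close>-calculus: a term denotes a set of tokens, and the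
  token \<open>Arr A t\<close> says that the function yields \<open>t\<close> on arguments including \<open>A\<close>. The sets \<open>A\<close> are
  countable rather than finite since the quantifier consults infinitely many values of its
  argument.\<close>

section \<open>Tokens and coherence\<close>

datatype tok = Num nat | Arr "tok cset" tok

inductive sub_tok :: "tok \<Rightarrow> tok \<Rightarrow> bool" where
  "x \<in> rcset A \<Longrightarrow> sub_tok x (Arr A t)"
| "sub_tok t (Arr A t)"

text \<open>Structural induction on tokens covers every element of the countable argument set as
  well as the result. This is what makes \<open>coh\<close> terminate.\<close>

lemma wfp_sub_tok: "wfp sub_tok"
proof (rule wfpUNIVI)
  fix P :: "tok \<Rightarrow> bool" and x
  assume "\<forall>x. (\<forall>y. sub_tok y x \<longrightarrow> P y) \<longrightarrow> P x"
  then have step: "P x" if "\<And>y. sub_tok y x \<Longrightarrow> P y" for x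
    using that by blast
  show "P x"
  proof (induction x)
    case (Num n)
    show ?case by (rule step) (auto elim: sub_tok.cases)
  next
    case (Arr A t)
    show ?case by (rule step) (auto elim: sub_tok.cases intro: Arr)
  qed
qed

text \<open>The recursive call is on two tokens that may both come from the same argument; the
  multiset of the arguments decreases nevertheless.\<close>

function coh :: "tok \<Rightarrow> tok \<Rightarrow> bool" where
  "coh (Num m) (Num n) \<longleftrightarrow> m = n"
| "coh (Num m) (Arr B t) \<longleftrightarrow> False"
| "coh (Arr A s) (Num n) \<longleftrightarrow> False"
| "coh (Arr A s) (Arr B t) \<longleftrightarrow>
     ((\<forall>x \<in> rcset A \<union> rcset B. \<forall>y \<in> rcset A \<union> rcset B. coh x y) \<longrightarrow> coh s t)"
  by pat_completeness auto
termination
proof (relation "inv_image (mult {(x, y). sub_tok x y}) (\<lambda>(x, y). {#x, y#})")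
  show "wf (inv_image (mult {(x, y). sub_tok x y}) (\<lambda>(x, y). {#x, y#}))"
    using wfp_sub_tok by (auto intro!: wf_mult simp: wfp_def)
next
  fix A B :: "tok cset" and s t x y
  assume "x \<in> rcset A \<union> rcset B" "y \<in> rcset A \<union> rcset B"
  then have "({#} + {#x, y#}, {#} + {#Arr A s, Arr B t#}) \<in> mult {(x, y). sub_tok x y}"
    by (intro one_step_implies_mult) (auto intro: sub_tok.intros)
  then show "((x, y), Arr A s, Arr B t) \<in> inv_image (mult {(x, y). sub_tok x y}) (\<lambda>(x, y). {#x, y#})"
    by simp
next
  fix A s B t
  have "({#} + {#s, t#}, {#} + {#Arr A s, Arr B t#}) \<in> mult {(x, y). sub_tok x y}"
    by (intro one_step_implies_mult) (auto intro: sub_tok.intros)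
  then show "((s, t), Arr A s, Arr B t) \<in> inv_image (mult {(x, y). sub_tok x y}) (\<lambda>(x, y). {#x, y#})"
    by simp
qed

text \<open>Coherent sets are the consistent values: at most one number, and no conflicting results
  on compatible arguments. This keeps a term from being both true and false.\<close>

definition coherent :: "tok set \<Rightarrow> bool" where
  "coherent X \<longleftrightarrow> (\<forall>x \<in> X. \<forall>y \<in> X. coh x y)"

lemma coherentI: "(\<And>x y. x \<in> X \<Longrightarrow> y \<in> X \<Longrightarrow> coh x y) \<Longrightarrow> coherent X"
  by (simp add: coherent_def)

lemma coherentD: "coherent X \<Longrightarrow> x \<in> X \<Longrightarrow> y \<in> X \<Longrightarrow> coh x y"
  by (simp add: coherent_def)

lemma coherent_subset: "coherent Y \<Longrightarrow> X \<subseteq> Y \<Longrightarrow> coherent X"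
  by (auto simp: coherent_def)

lemma coherent_Num [simp]: "coherent {Num n}"
  by (simp add: coherent_def)

lemma coh_Arr: "coh (Arr A s) (Arr B t) \<longleftrightarrow> (coherent (rcset A \<union> rcset B) \<longrightarrow> coh s t)"
  by (simp add: coherent_def)

declare coh.simps(4) [simp del]

lemma coherent_Num_unique: "coherent X \<Longrightarrow> Num m \<in> X \<Longrightarrow> Num n \<in> X \<Longrightarrow> m = n"
  using coherentD by fastforce

text \<open>A number token is incoherent with every other token, arrows included. A numeric value is
  thus the whole denotation, which later justifies replacing equals by equals.\<close>

lemma coherent_eq_Num:
  assumes "coherent X" "Num n \<in> X"
  shows "X = {Num n}"
proof -
  have "x = Num n" if "x \<in> X" for x
    using coherentD[OF assms(1) that assms(2)] by (cases x) auto
  then show ?thesis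
    using assms(2) by blast
qed

section \<open>Application, recursion and quantification\<close>

definition ap :: "tok set \<Rightarrow> tok set \<Rightarrow> tok set" where
  "ap F X = {t. \<exists>A. rcset A \<subseteq> X \<and> Arr A t \<in> F}"

lemma ap_mono: "F \<subseteq> G \<Longrightarrow> X \<subseteq> Y \<Longrightarrow> ap F X \<subseteq> ap G Y"
  unfolding ap_def by blast

lemma apI: "countable A \<Longrightarrow> A \<subseteq> X \<Longrightarrow> Arr (acset A) t \<in> F \<Longrightarrow> t \<in> ap F X"
  unfolding ap_def by (auto simp: acset_inverse intro!: exI[of _ "acset A"])

lemma apE:
  assumes "t \<in> ap F X"
  obtains A where "rcset A \<subseteq> X" "Arr A t \<in> F"
  using assms by (auto simp: ap_def)

text \<open>The argument sets of both arrows lie in the coherent set \<open>X\<close>, so the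
  coherence of the arrows passes to their results.\<close>

lemma coherent_ap:
  assumes "coherent F" "coherent X"
  shows "coherent (ap F X)"
proof (rule coherentI)
  fix s t
  assume "s \<in> ap F X" "t \<in> ap F X"
  then obtain A B where *: "rcset A \<subseteq> X" "Arr A s \<in> F" "rcset B \<subseteq> X" "Arr B t \<in> F"
    by (auto elim!: apE)
  then have "coherent (rcset A \<union> rcset B)"
    using assms(2) by (blast intro: coherent_subset)
  then show "coh s t"
    using coherentD[OF assms(1) *(2,4)] by (simp add: coh_Arr)
qed

text \<open>The step to \<open>Suc n\<close> is unrestricted exactly when \<open>n < K\<close>, so
  \<open>Suc K\<close> is the first argument at which function tokens are lost.\<close>

primrec recur :: "nat \<Rightarrow> tok set \<Rightarrow> tok set \<Rightarrow> nat \<Rightarrow> tok set" where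
  "recur K G H 0 = G"
| "recur K G H (Suc n) =
     (if n < K then ap (ap H {Num n}) (recur K G H n)
      else ap (ap H {Num n}) (recur K G H n) \<inter> range Num)"

lemma recur_mono: "G \<subseteq> G' \<Longrightarrow> H \<subseteq> H' \<Longrightarrow> recur K G H n \<subseteq> recur K G' H' n"
proof (induction n)
  case (Suc n)
  then have "ap (ap H {Num n}) (recur K G H n) \<subseteq> ap (ap H' {Num n}) (recur K G' H' n)"
    by (intro ap_mono) auto
  then show ?case by auto
qed simp

lemma coherent_recur: "coherent G \<Longrightarrow> coherent H \<Longrightarrow> coherent (recur K G H n)"
proof (induction n)
  case (Suc n)
  then have "coherent (ap (ap H {Num n}) (recur K G H n))"
    by (intro coherent_ap) auto
  then show ?case
    by (auto intro: coherent_subset)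
qed simp

text \<open>A token at \<open>Suc n\<close> uses one arrow of \<open>H\<close> and countably many
  tokens from stage \<open>n\<close>, and a countable union of countable parts is countable. Arrows
  with countable argument sets can therefore encode the recursion.\<close>

lemma recur_countable:
  assumes "t \<in> recur K G H n"
  shows "\<exists>A B. countable A \<and> countable B \<and> A \<subseteq> G \<and> B \<subseteq> H \<and> t \<in> recur K A B n"
  using assms
proof (induction n arbitrary: t)
  case 0
  then show ?case
    by (intro exI[of _ "{t}"] exI[of _ "{}"]) auto
next
  case (Suc n)
  from Suc.prems have "t \<in> ap (ap H {Num n}) (recur K G H n)"
    by (auto split: if_splits)
  then obtain C D where C: "rcset C \<subseteq> recur K G H n"
    and D: "rcset D \<subseteq> {Num n}" "Arr D (Arr C t) \<in> H"
    by (auto elim!: apE)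
  have "\<forall>c \<in> rcset C. \<exists>A B. countable A \<and> countable B \<and> A \<subseteq> G \<and> B \<subseteq> H \<and> c \<in> recur K A B n"
    using Suc.IH C by blast
  then obtain a b where ab: "\<And>c. c \<in> rcset C \<Longrightarrow>
      countable (a c) \<and> countable (b c) \<and> a c \<subseteq> G \<and> b c \<subseteq> H \<and> c \<in> recur K (a c) (b c) n"
    by metis
  define A B where "A = \<Union> (a ` rcset C)" and "B = insert (Arr D (Arr C t)) (\<Union> (b ` rcset C))"
  have AB: "countable A" "countable B" "A \<subseteq> G" "B \<subseteq> H"
    unfolding A_def B_def using ab D by (auto intro!: countable_UN)
  have "rcset C \<subseteq> recur K A B n"
  proof
    fix c
    assume c: "c \<in> rcset C"
    then have "recur K (a c) (b c) n \<subseteq> recur K A B n"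
      unfolding A_def B_def by (intro recur_mono) auto
    with ab[OF c] show "c \<in> recur K A B n" by blast
  qed
  moreover have "Arr C t \<in> ap B {Num n}"
    using D by (auto simp: ap_def B_def)
  ultimately have "t \<in> ap (ap B {Num n}) (recur K A B n)"
    by (auto simp: ap_def)
  \<comment> \<open>From \<open>K\<close> on, \<open>t\<close> is a number since it belongs to the
    restricted stage over \<open>G\<close> and \<open>H\<close>, so the intersection retains it here
    too.\<close>
  with Suc.prems have "t \<in> recur K A B (Suc n)"
    by (auto split: if_splits)
  with AB show ?case by blast
qed

text \<open>The graph of recursion as a curried function of base, step function and argument.
  Demanding a number in \<open>C\<close> makes it strict in the last argument.\<close>

definition rec_tok :: "nat \<Rightarrow> tok set" where
  "rec_tok K = {Arr A (Arr B (Arr C t)) | A B C t.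
     \<exists>n. Num n \<in> rcset C \<and> t \<in> recur K (rcset A) (rcset B) n}"

text \<open>Jointly coherent last arguments contain a single number, so both results belong to one
  stage of the recursion over the united arguments, which is coherent.\<close>

lemma coherent_rec_tok: "coherent (rec_tok K)"
proof (rule coherentI)
  fix x y
  assume "x \<in> rec_tok K" "y \<in> rec_tok K"
  then obtain A B C t n A' B' C' t' n' where
    x: "x = Arr A (Arr B (Arr C t))" "Num n \<in> rcset C" "t \<in> recur K (rcset A) (rcset B) n" and
    y: "y = Arr A' (Arr B' (Arr C' t'))" "Num n' \<in> rcset C'" "t' \<in> recur K (rcset A') (rcset B') n'"
    by (auto simp: rec_tok_def)
  show "coh x y"
    unfolding x y coh_Arr
  proof (intro impI)
    assume A: "coherent (rcset A \<union> rcset A')" and B: "coherent (rcset B \<union> rcset B')"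
      and C: "coherent (rcset C \<union> rcset C')"
    have "n = n'"
      using coherent_Num_unique[OF C] x y by auto
    moreover have "t \<in> recur K (rcset A \<union> rcset A') (rcset B \<union> rcset B') n"
      using x(3) by (rule subsetD[OF recur_mono, rotated 2]) auto
    moreover have "t' \<in> recur K (rcset A \<union> rcset A') (rcset B \<union> rcset B') n'"
      using y(3) by (rule subsetD[OF recur_mono, rotated 2]) auto
    ultimately show "coh t t'"
      using coherentD[OF coherent_recur[OF A B]] by blast
  qed
qed

text \<open>Monotonicity gives the first inclusion; for the second, \<open>recur_countable\<close>
  supplies the argument sets of the arrows.\<close>

lemma ap_rec_tok:
  "ap (ap (ap (rec_tok K) G) H) M = {t. \<exists>n. Num n \<in> M \<and> t \<in> recur K G H n}" (is "?L = ?R")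
proof
  show "?L \<subseteq> ?R"
  proof
    fix t
    assume "t \<in> ?L"
    then obtain A B C n where "rcset A \<subseteq> G" "rcset B \<subseteq> H" "rcset C \<subseteq> M" "Num n \<in> rcset C"
      "t \<in> recur K (rcset A) (rcset B) n"
      by (auto elim!: apE simp: rec_tok_def)
    then show "t \<in> ?R"
      using recur_mono by blast
  qed
next
  show "?R \<subseteq> ?L"
  proof
    fix t
    assume "t \<in> ?R"
    then obtain n where n: "Num n \<in> M" "t \<in> recur K G H n" by blast
    then obtain A B where AB: "countable A" "countable B" "A \<subseteq> G" "B \<subseteq> H" "t \<in> recur K A B n"
      using recur_countable by meson
    have "Arr (acset A) (Arr (acset B) (Arr (acset {Num n}) t)) \<in> rec_tok K"
      unfolding rec_tok_def using AB by (auto simp: acset_inverse)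
    then have "Arr (acset {Num n}) t \<in> ap (ap (rec_tok K) G) H"
      using apI[OF AB(1,3)] apI[OF AB(2,4)] by blast
    with n(1) show "t \<in> ?L"
      using apI[of "{Num n}" M] by blast
  qed
qed

text \<open>\<open>Num 1\<close> and \<open>Num 0\<close> serve as truth and falsity, matching the
  rules that equate formulas with numerals. If neither clause applies, the quantified formula has no
  value.\<close>

definition univ_tok :: "tok set" where
  "univ_tok = {Arr A (Num 1) | A. \<forall>n. Num 1 \<in> ap (rcset A) {Num n}} \<union>
     {Arr A (Num 0) | A. \<exists>n. Num 0 \<in> ap (rcset A) {Num n}}"

text \<open>If one argument is true at all numbers and another is false at \<open>n\<close>, their
  union yields both 1 and 0 at \<open>n\<close>. Arrows with different results thus never have
  jointly coherent arguments.\<close>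

lemma coherent_univ_tok: "coherent univ_tok"
proof -
  have incoh: "\<not> coherent (rcset A \<union> rcset B)"
    if "\<forall>n. Num 1 \<in> ap (rcset A) {Num n}" "Num 0 \<in> ap (rcset B) {Num n}" for A B n
  proof
    assume "coherent (rcset A \<union> rcset B)"
    then have "coherent (ap (rcset A \<union> rcset B) {Num n})"
      by (intro coherent_ap) auto
    moreover have "Num 1 \<in> ap (rcset A \<union> rcset B) {Num n}"
      using that(1) ap_mono[of "rcset A" "rcset A \<union> rcset B" "{Num n}" "{Num n}"] by blast
    moreover have "Num 0 \<in> ap (rcset A \<union> rcset B) {Num n}"
      using that(2) ap_mono[of "rcset B" "rcset A \<union> rcset B" "{Num n}" "{Num n}"] by blast
    ultimately show False
      using coherent_Num_unique by fastforce
  qed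
  then have "\<not> coherent (rcset B \<union> rcset A)"
    if "\<forall>n. Num 1 \<in> ap (rcset A) {Num n}" "Num 0 \<in> ap (rcset B) {Num n}" for A B n
    using that by (metis Un_commute)
  with incoh show ?thesis
    unfolding univ_tok_def by (intro coherentI) (auto simp: coh_Arr simp del: One_nat_def)
qed

lemma Num_1_univ: "Num 1 \<in> ap univ_tok F \<longleftrightarrow> (\<forall>n. Num 1 \<in> ap F {Num n})"
proof
  assume "Num 1 \<in> ap univ_tok F"
  then obtain S where "rcset S \<subseteq> F" "\<forall>n. Num 1 \<in> ap (rcset S) {Num n}"
    by (auto elim!: apE simp: univ_tok_def)
  then show "\<forall>n. Num 1 \<in> ap F {Num n}"
    using ap_mono by blast
next
  assume "\<forall>n. Num 1 \<in> ap F {Num n}"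
  then have "\<forall>n. \<exists>A. rcset A \<subseteq> {Num n} \<and> Arr A (Num 1) \<in> F"
    by (simp add: ap_def)
  then obtain A where A: "\<And>n. rcset (A n) \<subseteq> {Num n} \<and> Arr (A n) (Num 1) \<in> F"
    by metis
  \<comment> \<open>One arrow for each number is enough evidence; the set may be infinite, but it is
    countable.\<close>
  define S where "S = range (\<lambda>n. Arr (A n) (Num 1))"
  have "Num 1 \<in> ap S {Num n}" for n
    using A unfolding ap_def S_def by blast
  then have "Arr (acset S) (Num 1) \<in> univ_tok"
    by (simp add: univ_tok_def S_def acset_inverse)
  moreover have "countable S" "S \<subseteq> F"
    using A by (auto simp: S_def)
  ultimately show "Num 1 \<in> ap univ_tok F"
    by (metis apI)
qed

lemma Num_0_univ: "Num 0 \<in> ap univ_tok F \<longleftrightarrow> (\<exists>n. Num 0 \<in> ap F {Num n})"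
proof
  assume "Num 0 \<in> ap univ_tok F"
  then obtain S where "rcset S \<subseteq> F" "Arr S (Num 0) \<in> univ_tok"
    by (rule apE)
  then obtain n where "rcset S \<subseteq> F" "Num 0 \<in> ap (rcset S) {Num n}"
    by (auto simp: univ_tok_def)
  then show "\<exists>n. Num 0 \<in> ap F {Num n}"
    using subsetD[OF ap_mono[of "rcset S" F "{Num n}" "{Num n}"]] by auto
next
  assume "\<exists>n. Num 0 \<in> ap F {Num n}"
  then obtain n A where A: "rcset A \<subseteq> {Num n}" "Arr A (Num 0) \<in> F"
    by (auto simp: ap_def)
  then have "Num 0 \<in> ap {Arr A (Num 0)} {Num n}"
    by (auto simp: ap_def)
  then have "\<exists>n. Num 0 \<in> ap (rcset (acset {Arr A (Num 0)})) {Num n}"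
    by (intro exI[of _ n]) (simp add: acset_inverse)
  then have "Arr (acset {Arr A (Num 0)}) (Num 0) \<in> univ_tok"
    by (simp add: univ_tok_def)
  with A(2) show "Num 0 \<in> ap univ_tok F"
    using apI[of "{Arr A (Num 0)}" F] by simp
qed

section \<open>Denotations\<close>

text \<open>Disjunction is parallel: one true side suffices even if the other has no value, as the
  introduction rules require. In negation, the bound \<open>n \<le> 1\<close> prevents truncated
  subtraction from making the negation of a number above 1 false.\<close>

fun den :: "nat \<Rightarrow> trm \<Rightarrow> (nat \<Rightarrow> tok set) \<Rightarrow> tok set" where
  "den K (Var i) \<rho> = \<rho> i"
| "den K Bot \<rho> = {}"
| "den K Zero \<rho> = {Num 0}"
| "den K (Succ t) \<rho> = {Num (Suc n) | n. Num n \<in> den K t \<rho>}"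
| "den K (t \<^bold>= u) \<rho> = {Num (of_bool (m = n)) | m n. Num m \<in> den K t \<rho> \<and> Num n \<in> den K u \<rho>}"
| "den K (\<^bold>\<not> t) \<rho> = {Num (1 - n) | n. n \<le> 1 \<and> Num n \<in> den K t \<rho>}"
| "den K (t \<^bold>\<or> u) \<rho> = {x. x = Num 1 \<and> x \<in> den K t \<rho> \<union> den K u \<rho>} \<union>
     {x. x = Num 0 \<and> x \<in> den K t \<rho> \<inter> den K u \<rho>}"
| "den K (Lam b) \<rho> = {Arr A t | A t. t \<in> den K b (case_nat (rcset A) \<rho>)}"
| "den K (t \<cdot> u) \<rho> = ap (den K t \<rho>) (den K u \<rho>)"
| "den K Rec \<rho> = rec_tok K"
| "den K Univ \<rho> = univ_tok"

lemma case_nat_mono: "A \<subseteq> B \<Longrightarrow> (\<And>i. \<rho> i \<subseteq> \<sigma> i) \<Longrightarrow> case_nat A \<rho> i \<subseteq> case_nat B \<sigma> i"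
  by (cases i) auto

lemma den_mono: "(\<And>i. \<rho> i \<subseteq> \<sigma> i) \<Longrightarrow> den K t \<rho> \<subseteq> den K t \<sigma>"
proof (induction t arbitrary: \<rho> \<sigma>)
  case (Eq t u)
  have "den K t \<rho> \<subseteq> den K t \<sigma>" "den K u \<rho> \<subseteq> den K u \<sigma>"
    by (intro Eq.IH Eq.prems)+
  then show ?case
    unfolding den.simps by blast
next
  case (Or t u)
  have "den K t \<rho> \<subseteq> den K t \<sigma>" "den K u \<rho> \<subseteq> den K u \<sigma>"
    by (intro Or.IH Or.prems)+
  then show ?case
    unfolding den.simps by blast
next
  case (App t u)
  from App.IH(1)[OF App.prems] App.IH(2)[OF App.prems] show ?case by (simp add: ap_mono)
next
  case (Lam b)
  have "den K b (case_nat A \<rho>) \<subseteq> den K b (case_nat A \<sigma>)" for A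
    by (intro Lam.IH case_nat_mono Lam.prems order_refl)
  then show ?case by auto
next
  case (Succ t)
  have "den K t \<rho> \<subseteq> den K t \<sigma>"
    by (intro Succ.IH Succ.prems)
  then show ?case
    unfolding den.simps by blast
next
  case (Neg t)
  have "den K t \<rho> \<subseteq> den K t \<sigma>"
    by (intro Neg.IH Neg.prems)
  then show ?case
    unfolding den.simps by blast
qed auto

lemma coherent_case_nat: "coherent A \<Longrightarrow> (\<And>i. coherent (\<rho> i)) \<Longrightarrow> coherent (case_nat A \<rho> i)"
  by (cases i) auto

text \<open>Each component contains at most one number, so the arithmetical and logical operations
  have at most one result. For \<open>Lam\<close>, both results are compared in the environment with
  the united arguments.\<close>

lemma coherent_den: "(\<And>i. coherent (\<rho> i)) \<Longrightarrow> coherent (den K t \<rho>)"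
proof (induction t arbitrary: \<rho>)
  case (Succ t)
  have "coherent (den K t \<rho>)"
    by (intro Succ.IH Succ.prems)
  then obtain n where "\<And>i. Num i \<in> den K t \<rho> \<Longrightarrow> i = n"
    by (metis coherent_Num_unique)
  then have "den K (Succ t) \<rho> \<subseteq> {Num (Suc n)}"
    by auto
  then show ?case
    by (rule coherent_subset[OF coherent_Num])
next
  case (Eq t u)
  have "coherent (den K t \<rho>)" "coherent (den K u \<rho>)"
    by (intro Eq.IH Eq.prems)+
  then obtain m n where "\<And>i. Num i \<in> den K t \<rho> \<Longrightarrow> i = m" "\<And>i. Num i \<in> den K u \<rho> \<Longrightarrow> i = n"
    by (metis coherent_Num_unique)
  then have "den K (t \<^bold>= u) \<rho> \<subseteq> {Num (of_bool (m = n))}"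
    by (auto split: split_of_bool)
  then show ?case
    by (rule coherent_subset[OF coherent_Num])
next
  case (Neg t)
  have "coherent (den K t \<rho>)"
    by (intro Neg.IH Neg.prems)
  then obtain n where "\<And>i. Num i \<in> den K t \<rho> \<Longrightarrow> i = n"
    by (metis coherent_Num_unique)
  then have "den K (\<^bold>\<not> t) \<rho> \<subseteq> {Num (1 - n)}"
    by auto
  then show ?case
    by (rule coherent_subset[OF coherent_Num])
next
  case (Or t u)
  have "coherent (den K t \<rho>)" "coherent (den K u \<rho>)"
    by (intro Or.IH Or.prems)+
  then have "\<not> (Num 1 \<in> den K t \<rho> \<union> den K u \<rho> \<and> Num 0 \<in> den K t \<rho> \<inter> den K u \<rho>)"
    by (metis Int_iff Un_iff coherent_Num_unique zero_neq_one)
  then show ?case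
    by (intro coherentI) (auto simp del: One_nat_def)
next
  case (Lam b)
  show ?case
  proof (rule coherentI)
    fix x y
    assume "x \<in> den K (Lam b) \<rho>" "y \<in> den K (Lam b) \<rho>"
    then obtain A s B t where
      x: "x = Arr A s" "s \<in> den K b (case_nat (rcset A) \<rho>)" and
      y: "y = Arr B t" "t \<in> den K b (case_nat (rcset B) \<rho>)"
      by auto
    show "coh x y"
      unfolding x y coh_Arr
    proof
      let ?X = "den K b (case_nat (rcset A \<union> rcset B) \<rho>)"
      assume "coherent (rcset A \<union> rcset B)"
      then have "coherent ?X"
        by (intro Lam.IH coherent_case_nat Lam.prems)
      moreover have "s \<in> ?X"
        using x(2) by (rule subsetD[OF den_mono, rotated]) (simp add: case_nat_mono)
      moreover have "t \<in> ?X"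
        using y(2) by (rule subsetD[OF den_mono, rotated]) (simp add: case_nat_mono)
      ultimately show "coh s t"
        by (rule coherentD)
    qed
  qed
next
  case (App t u)
  then show ?case by (simp add: coherent_ap)
qed (simp_all add: coherent_def[of "{}"] coherent_rec_tok coherent_univ_tok)

section \<open>Countable continuity of denotations\<close>

definition countable_part :: "(nat \<Rightarrow> tok set) \<Rightarrow> (nat \<Rightarrow> tok set) \<Rightarrow> bool" where
  "countable_part \<sigma> \<rho> \<longleftrightarrow> (\<forall>i. countable (\<sigma> i) \<and> \<sigma> i \<subseteq> \<rho> i)"

lemma countable_part_case_nat:
  "countable_part \<sigma> (case_nat X \<rho>) \<longleftrightarrow>
     countable (\<sigma> 0) \<and> \<sigma> 0 \<subseteq> X \<and> countable_part (\<lambda>i. \<sigma> (Suc i)) \<rho>"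
proof -
  have "countable_part \<sigma> (case_nat X \<rho>)"
    if "countable (\<sigma> 0)" "\<sigma> 0 \<subseteq> X" "countable_part (\<lambda>i. \<sigma> (Suc i)) \<rho>"
    unfolding countable_part_def
  proof
    show "countable (\<sigma> i) \<and> \<sigma> i \<subseteq> case_nat X \<rho> i" for i
      using that by (cases i) (simp_all add: countable_part_def)
  qed
  moreover have "countable (\<sigma> 0) \<and> \<sigma> 0 \<subseteq> X \<and> countable_part (\<lambda>i. \<sigma> (Suc i)) \<rho>"
    if *: "countable_part \<sigma> (case_nat X \<rho>)"
    using *[unfolded countable_part_def, rule_format, of 0]
      *[unfolded countable_part_def, rule_format, of "Suc _"]
    by (simp add: countable_part_def)
  ultimately show ?thesis
    by blast
qed

text \<open>One part is chosen for each element of \<open>X\<close>; monotonicity of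
  \<open>P\<close> carries every choice over to the pointwise union.\<close>

lemma countable_part_UN:
  assumes "countable X" and "\<And>x. x \<in> X \<Longrightarrow> \<exists>\<sigma>. countable_part \<sigma> \<rho> \<and> P x \<sigma>"
    and mono: "\<And>x \<sigma> \<tau>. P x \<sigma> \<Longrightarrow> (\<And>i. \<sigma> i \<subseteq> \<tau> i) \<Longrightarrow> P x \<tau>"
  shows "\<exists>\<sigma>. countable_part \<sigma> \<rho> \<and> (\<forall>x \<in> X. P x \<sigma>)"
proof -
  from assms(2) obtain S where S: "\<And>x. x \<in> X \<Longrightarrow> countable_part (S x) \<rho> \<and> P x (S x)"
    by metis
  have "countable_part (\<lambda>i. \<Union>x \<in> X. S x i) \<rho>"
    unfolding countable_part_def
  proof (intro allI conjI)
    fix i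
    show "countable (\<Union>x \<in> X. S x i)"
      using assms(1) S by (intro countable_UN) (auto simp: countable_part_def)
    show "(\<Union>x \<in> X. S x i) \<subseteq> \<rho> i"
      using S by (auto simp: countable_part_def)
  qed
  moreover have "P x (\<lambda>i. \<Union>x \<in> X. S x i)" if "x \<in> X" for x
  proof (rule mono)
    show "P x (S x)"
      using S that by blast
    show "S x i \<subseteq> (\<Union>x \<in> X. S x i)" for i
      using that by blast
  qed
  ultimately show ?thesis by blast
qed

lemma countable_part_join:
  assumes \<sigma>: "countable_part \<sigma> \<rho>" "S \<subseteq> den K b \<sigma>" and \<tau>: "countable_part \<tau> \<rho>" "T \<subseteq> den K c \<tau>"
  obtains \<upsilon> where "countable_part \<upsilon> \<rho>" "S \<subseteq> den K b \<upsilon>" "T \<subseteq> den K c \<upsilon>"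
proof (rule that[of "\<lambda>i. \<sigma> i \<union> \<tau> i"])
  show "countable_part (\<lambda>i. \<sigma> i \<union> \<tau> i) \<rho>"
    using \<sigma>(1) \<tau>(1) by (auto simp: countable_part_def)
  show "S \<subseteq> den K b (\<lambda>i. \<sigma> i \<union> \<tau> i)"
    using \<sigma>(2) by (rule order_trans) (rule den_mono, blast)
  show "T \<subseteq> den K c (\<lambda>i. \<sigma> i \<union> \<tau> i)"
    using \<tau>(2) by (rule order_trans) (rule den_mono, blast)
qed

text \<open>A token of a compound term needs only countably many tokens of its components, hence of
  the environment. This supplies the arrows for the harder half of semantic beta conversion.\<close>

lemma den_countable: "t \<in> den K b \<rho> \<Longrightarrow> \<exists>\<sigma>. countable_part \<sigma> \<rho> \<and> t \<in> den K b \<sigma>"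
proof (induction b arbitrary: t \<rho>)
  case (Var i)
  then show ?case
    by (intro exI[of _ "(\<lambda>_. {})(i := {t})"]) (auto simp: countable_part_def)
next
  case (Succ b)
  then obtain n where "t = Num (Suc n)" "Num n \<in> den K b \<rho>" by auto
  then show ?case
    using Succ.IH[of "Num n" \<rho>] by auto
next
  case (Neg b)
  then obtain n where "t = Num (1 - n)" "n \<le> 1" "Num n \<in> den K b \<rho>" by auto
  then show ?case
    using Neg.IH[of "Num n" \<rho>] by auto
next
  case (Eq b c)
  from Eq.prems obtain m n where t: "t = Num (of_bool (m = n))"
    and "Num m \<in> den K b \<rho>" "Num n \<in> den K c \<rho>" by auto
  with Eq.IH obtain \<sigma> \<tau> where "countable_part \<sigma> \<rho>" "{Num m} \<subseteq> den K b \<sigma>"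
    "countable_part \<tau> \<rho>" "{Num n} \<subseteq> den K c \<tau>" by (metis empty_subsetI insert_subset)
  then obtain \<upsilon> where "countable_part \<upsilon> \<rho>" "{Num m} \<subseteq> den K b \<upsilon>" "{Num n} \<subseteq> den K c \<upsilon>"
    by (rule countable_part_join)
  then show ?case
    unfolding t by (intro exI[of _ \<upsilon>]) auto
next
  case (Or b c)
  from Or.prems consider "t = Num 1" "Num 1 \<in> den K b \<rho>" | "t = Num 1" "Num 1 \<in> den K c \<rho>"
    | "t = Num 0" "Num 0 \<in> den K b \<rho>" "Num 0 \<in> den K c \<rho>" by auto
  then show ?case
  proof cases
    case 3
    with Or.IH obtain \<sigma> \<tau> where "countable_part \<sigma> \<rho>" "{Num 0} \<subseteq> den K b \<sigma>"
      "countable_part \<tau> \<rho>" "{Num 0} \<subseteq> den K c \<tau>" by (metis empty_subsetI insert_subset)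
    then obtain \<upsilon> where "countable_part \<upsilon> \<rho>" "{Num 0} \<subseteq> den K b \<upsilon>" "{Num 0} \<subseteq> den K c \<upsilon>"
      by (rule countable_part_join)
    then show ?thesis
      unfolding 3 by (intro exI[of _ \<upsilon>]) auto
  next
    case 1
    then show ?thesis
      using Or.IH(1)[of "Num 1" \<rho>] by auto
  next
    case 2
    then show ?thesis
      using Or.IH(2)[of "Num 1" \<rho>] by auto
  qed
next
  case (Lam b)
  then obtain A s where t: "t = Arr A s" "s \<in> den K b (case_nat (rcset A) \<rho>)" by auto
  with Lam.IH obtain \<sigma> where \<sigma>: "countable_part \<sigma> (case_nat (rcset A) \<rho>)" "s \<in> den K b \<sigma>"
    by meson
  from \<sigma>(1) have \<sigma>1: "\<sigma> 0 \<subseteq> rcset A" "countable_part (\<lambda>i. \<sigma> (Suc i)) \<rho>"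
    by (simp_all only: countable_part_case_nat)
  \<comment> \<open>The part of variable 0 lies in \<open>rcset A\<close>, so restoring
    \<open>rcset A\<close> only enlarges the environment; the remaining variables give the part
    sought.\<close>
  have "\<sigma> i \<subseteq> case_nat (rcset A) (\<lambda>i. \<sigma> (Suc i)) i" for i
    using \<sigma>1(1) by (cases i) simp_all
  then have "s \<in> den K b (case_nat (rcset A) (\<lambda>i. \<sigma> (Suc i)))"
    using \<sigma>(2) den_mono by blast
  then have "t \<in> den K (Lam b) (\<lambda>i. \<sigma> (Suc i))"
    unfolding t by simp
  with \<sigma>1(2) show ?case
    by blast
next
  case (App b c)
  then obtain A where A: "rcset A \<subseteq> den K c \<rho>" "Arr A t \<in> den K b \<rho>"
    by (auto elim: apE)
  from App.IH(1)[OF A(2)] obtain \<sigma> where \<sigma>: "countable_part \<sigma> \<rho>" "Arr A t \<in> den K b \<sigma>"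
    by blast
  \<comment> \<open>Each of the countably many argument tokens has a part of its own; their union
    serves all of them.\<close>
  have "\<exists>\<tau>. countable_part \<tau> \<rho> \<and> (\<forall>x \<in> rcset A. x \<in> den K c \<tau>)"
  proof (rule countable_part_UN)
    show "\<exists>\<tau>. countable_part \<tau> \<rho> \<and> x \<in> den K c \<tau>" if "x \<in> rcset A" for x
      using A(1) that by (intro App.IH(2)) blast
    show "x \<in> den K c \<tau>'" if "x \<in> den K c \<tau>" "\<And>i. \<tau> i \<subseteq> \<tau>' i" for x \<tau> \<tau>'
      using that(1) by (rule subsetD[OF den_mono, rotated]) (rule that(2))
  qed simp
  then obtain \<tau> where \<tau>: "countable_part \<tau> \<rho>" "rcset A \<subseteq> den K c \<tau>"
    by blast
  from \<sigma>(2) have "{Arr A t} \<subseteq> den K b \<sigma>"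
    by simp
  from countable_part_join[OF \<sigma>(1) this \<tau>] obtain \<upsilon> where \<upsilon>: "countable_part \<upsilon> \<rho>" "{Arr A t} \<subseteq> den K b \<upsilon>" "rcset A \<subseteq> den K c \<upsilon>"
    by blast
  then have "t \<in> den K (b \<cdot> c) \<upsilon>"
    by (auto simp: ap_def)
  with \<upsilon>(1) show ?case
    by blast
qed (auto simp: countable_part_def intro!: exI[of _ "\<lambda>_. {}"])

text \<open>This is beta conversion in the model. Monotonicity gives one inclusion; for the other,
  the countable part of \<open>X\<close> that a token uses becomes the argument set of an
  arrow.\<close>

lemma ap_Lam: "ap (den K (Lam b) \<rho>) X = den K b (case_nat X \<rho>)"
proof
  show "ap (den K (Lam b) \<rho>) X \<subseteq> den K b (case_nat X \<rho>)"
  proof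
    fix t
    assume "t \<in> ap (den K (Lam b) \<rho>) X"
    then obtain A where "rcset A \<subseteq> X" "t \<in> den K b (case_nat (rcset A) \<rho>)"
      by (auto elim: apE)
    then show "t \<in> den K b (case_nat X \<rho>)"
      using subsetD[OF den_mono[of "case_nat (rcset A) \<rho>" "case_nat X \<rho>"]]
      by (simp add: case_nat_mono)
  qed
next
  show "den K b (case_nat X \<rho>) \<subseteq> ap (den K (Lam b) \<rho>) X"
  proof
    fix t
    assume "t \<in> den K b (case_nat X \<rho>)"
    then obtain \<sigma> where \<sigma>: "countable_part \<sigma> (case_nat X \<rho>)" "t \<in> den K b \<sigma>"
      using den_countable by blast
    from \<sigma>(1) have \<sigma>1: "countable (\<sigma> 0)" "\<sigma> 0 \<subseteq> X" "countable_part (\<lambda>i. \<sigma> (Suc i)) \<rho>"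
      by (simp_all only: countable_part_case_nat)
    have "\<sigma> i \<subseteq> case_nat (\<sigma> 0) \<rho> i" for i
      using \<sigma>1(3) by (cases i) (auto simp: countable_part_def)
    then have "t \<in> den K b (case_nat (\<sigma> 0) \<rho>)"
      using \<sigma>(2) den_mono by blast
    with \<sigma>1 show "t \<in> ap (den K (Lam b) \<rho>) X"
      using apI[of "\<sigma> 0" X] by (simp add: acset_inverse)
  qed
qed

section \<open>Shifting, substitution and instantiation in the model\<close>

lemma den_shift: "den K (shift k t) \<rho> = den K t (\<lambda>i. \<rho> (if i < k then i else Suc i))"
proof (induction t arbitrary: k \<rho>)
  case (Lam b)
  have "(\<lambda>i. case_nat A \<rho> (if i < Suc k then i else Suc i)) =
      case_nat A (\<lambda>i. \<rho> (if i < k then i else Suc i))" for A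
    by (auto simp: fun_eq_iff split: nat.splits)
  then show ?case by (simp add: Lam.IH)
qed auto

lemma den_up: "den K (\<up> t) (case_nat X \<rho>) = den K t \<rho>"
  by (simp add: den_shift)

lemma den_subst: "den K ([i \<^bold>\<mapsto> s] t) \<rho> = den K t (\<rho>(i := den K s \<rho>))"
proof (induction t arbitrary: i s \<rho>)
  case (Lam b)
  have eq: "(case_nat A \<rho>)(Suc i := X) = case_nat A (\<rho>(i := X))" for A X
    by (auto simp: fun_eq_iff split: nat.splits)
  show ?case
    unfolding subst.simps den.simps Lam.IH den_up eq ..
qed auto

text \<open>The index \<open>k\<close> is arbitrary because instantiation under \<open>Lam\<close>
  raises it; beta steps use index 0.\<close>

lemma den_inst:
  "den K (inst k s t) \<rho> =
     den K t (\<lambda>i. if i < k then \<rho> i else if i = k then den K s \<rho> else \<rho> (i - 1))"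
proof (induction t arbitrary: k s \<rho>)
  case (Lam b)
  have eq: "(\<lambda>i. if i < Suc k then case_nat A \<rho> i else if i = Suc k then X else case_nat A \<rho> (i - 1)) =
      case_nat A (\<lambda>i. if i < k then \<rho> i else if i = k then X else \<rho> (i - 1))" for A X
    by (auto simp: fun_eq_iff split: nat.splits)
  show ?case
    unfolding inst.simps den.simps Lam.IH den_up eq ..
qed auto

lemma den_inst_0: "den K (inst 0 s t) \<rho> = den K t (case_nat (den K s \<rho>) \<rho>)"
  unfolding den_inst by (rule arg_cong[of _ _ "den K t"]) (auto simp: fun_eq_iff split: nat.splits)

lemma den_fv: "(\<And>i. i \<in> fv t \<Longrightarrow> \<rho> i = \<sigma> i) \<Longrightarrow> den K t \<rho> = den K t \<sigma>"
proof (induction t arbitrary: \<rho> \<sigma>)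
  case (Lam b)
  have "den K b (case_nat A \<rho>) = den K b (case_nat A \<sigma>)" for A
    by (intro Lam.IH) (auto simp: Lam.prems split: nat.splits)
  then show ?case by simp
next
  case (Eq t u)
  from Eq.IH(1)[of \<rho> \<sigma>] Eq.IH(2)[of \<rho> \<sigma>] Eq.prems show ?case by simp
next
  case (Or t u)
  from Or.IH(1)[of \<rho> \<sigma>] Or.IH(2)[of \<rho> \<sigma>] Or.prems show ?case by simp
next
  case (App t u)
  from App.IH(1)[of \<rho> \<sigma>] App.IH(2)[of \<rho> \<sigma>] App.prems show ?case by simp
next
  case (Succ t)
  from Succ.IH[of \<rho> \<sigma>] Succ.prems show ?case by simp
next
  case (Neg t)
  from Neg.IH[of \<rho> \<sigma>] Neg.prems show ?case by simp
qed auto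

lemma numl_0 [simp]: "numl 0 = Zero" and numl_Suc [simp]: "numl (Suc n) = Succ (numl n)"
  by (simp_all add: numl_def)

lemma den_numl [simp]: "den K (numl n) \<rho> = {Num n}"
  by (induction n) auto

section \<open>Soundness\<close>

declare One_nat_def [simp del]
declare den.simps(5-8) [simp del]

text \<open>With \<open>Num 1\<close> read as truth and \<open>Num 0\<close> as falsity, these
  equivalences reduce compound formulas to their parts, after which many rules are sound by plain
  logic.\<close>

lemma holds_Eq: "Num 1 \<in> den K (a \<^bold>= b) \<rho> \<longleftrightarrow> (\<exists>n. Num n \<in> den K a \<rho> \<and> Num n \<in> den K b \<rho>)"
  and fails_Eq: "Num 0 \<in> den K (a \<^bold>= b) \<rho> \<longleftrightarrow>
    (\<exists>m n. m \<noteq> n \<and> Num m \<in> den K a \<rho> \<and> Num n \<in> den K b \<rho>)"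
  by (auto simp: den.simps(5) split: split_of_bool)

lemma fails_Eq_Succ: "Num 0 \<in> den K (Succ a \<^bold>= Succ b) \<rho> \<longleftrightarrow> Num 0 \<in> den K (a \<^bold>= b) \<rho>"
proof
  assume "Num 0 \<in> den K (a \<^bold>= b) \<rho>"
  then obtain m n where "m \<noteq> n" "Num m \<in> den K a \<rho>" "Num n \<in> den K b \<rho>"
    by (auto simp: fails_Eq)
  then show "Num 0 \<in> den K (Succ a \<^bold>= Succ b) \<rho>"
    unfolding fails_Eq by (intro exI[of _ "Suc m"] exI[of _ "Suc n"]) auto
qed (auto simp: fails_Eq)

lemma holds_Neg: "Num 1 \<in> den K (\<^bold>\<not> a) \<rho> \<longleftrightarrow> Num 0 \<in> den K a \<rho>"
  and fails_Neg: "Num 0 \<in> den K (\<^bold>\<not> a) \<rho> \<longleftrightarrow> Num 1 \<in> den K a \<rho>"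
proof -
  have "Suc 0 = Suc 0 - n \<and> n \<le> Suc 0 \<longleftrightarrow> n = 0" "0 = Suc 0 - n \<and> n \<le> Suc 0 \<longleftrightarrow> n = Suc 0" for n
    by auto
  then show "Num 1 \<in> den K (\<^bold>\<not> a) \<rho> \<longleftrightarrow> Num 0 \<in> den K a \<rho>"
    "Num 0 \<in> den K (\<^bold>\<not> a) \<rho> \<longleftrightarrow> Num 1 \<in> den K a \<rho>"
    unfolding One_nat_def den.simps(6) by (simp_all, metis+)
qed

lemma holds_Or: "Num 1 \<in> den K (a \<^bold>\<or> b) \<rho> \<longleftrightarrow> Num 1 \<in> den K a \<rho> \<or> Num 1 \<in> den K b \<rho>"
  and fails_Or: "Num 0 \<in> den K (a \<^bold>\<or> b) \<rho> \<longleftrightarrow> Num 0 \<in> den K a \<rho> \<and> Num 0 \<in> den K b \<rho>"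
  by (auto simp: den.simps(7))

lemmas holds_simps = holds_Eq fails_Eq holds_Neg fails_Neg holds_Or fails_Or

definition models :: "nat \<Rightarrow> (nat \<Rightarrow> tok set) \<Rightarrow> trm fset \<Rightarrow> bool" where
  "models K \<rho> \<Gamma> \<longleftrightarrow> (\<forall>i. coherent (\<rho> i)) \<and> (\<forall>g. g |\<in>| \<Gamma> \<longrightarrow> Num 1 \<in> den K g \<rho>)"

primrec valid :: "nat \<Rightarrow> sequent \<Rightarrow> bool" where
  "valid K (\<Gamma> \<turnstile> c) \<longleftrightarrow> (\<forall>\<rho>. models K \<rho> \<Gamma> \<longrightarrow> Num 1 \<in> den K c \<rho>)"

lemma models_coherent_den:
  assumes "models K \<rho> \<Gamma>"
  shows "coherent (den K t \<rho>)"
  by (rule coherent_den) (use assms in \<open>simp add: models_def\<close>)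

lemma models_Num_unique:
  assumes "models K \<rho> \<Gamma>" "Num m \<in> den K t \<rho>" "Num n \<in> den K t \<rho>"
  shows "m = n"
  using coherent_Num_unique[OF models_coherent_den[OF assms(1)] assms(2,3)] .

lemma models_den_eq_Num:
  assumes "models K \<rho> \<Gamma>" "Num n \<in> den K t \<rho>"
  shows "den K t \<rho> = {Num n}"
  using coherent_eq_Num[OF models_coherent_den[OF assms(1)] assms(2)] .

lemma models_insert: "models K \<rho> (\<Gamma> \<^bold>, a) \<longleftrightarrow> models K \<rho> \<Gamma> \<and> Num 1 \<in> den K a \<rho>"
  by (auto simp: models_def)

lemma models_subst:
  assumes "models K \<rho> (fimage (subst i s) \<Gamma>)"
  shows "models K (\<rho>(i := den K s \<rho>)) \<Gamma>"
  unfolding models_def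
proof (intro conjI allI impI)
  show "coherent ((\<rho>(i := den K s \<rho>)) j)" for j
    using assms models_coherent_den[OF assms, of s] by (simp add: models_def)
  show "Num 1 \<in> den K g (\<rho>(i := den K s \<rho>))" if "g |\<in>| \<Gamma>" for g
    using assms fimageI[OF that, of "subst i s"]
    by (simp add: models_def den_subst[symmetric])
qed

lemma models_fresh:
  "models K \<rho> \<Gamma> \<Longrightarrow> (\<And>t. t |\<in>| \<Gamma> \<Longrightarrow> i \<notin> fv t) \<Longrightarrow> coherent X \<Longrightarrow> models K (\<rho>(i := X)) \<Gamma>"
  using den_fv[of _ "\<rho>(i := X)" \<rho>] by (fastforce simp: models_def)

lemma models_up:
  "models K \<rho> \<Gamma> \<Longrightarrow> models K (case_nat {Num n} \<rho>) (fimage (shift 0) \<Gamma> \<^bold>, (Var 0) \<^bold>N)"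
  by (auto simp: models_def den_up coherent_case_nat holds_Eq)

text \<open>Beta and the base of the recursion are equalities in every model. Unfolding at the
  successor of \<open>numl n\<close> is one as soon as \<open>n < K\<close>, the step being
  unrestricted then.\<close>

lemma head_step_sound: "c \<triangleright> c' \<Longrightarrow> \<forall>\<^sub>F K in sequentially. \<forall>\<rho>. den K c \<rho> = den K c' \<rho>"
proof (induction rule: head_step.induct)
  case (beta b t)
  show ?case by (simp add: ap_Lam den_inst_0)
next
  case (rec_0 g h)
  show ?case by (simp add: ap_rec_tok)
next
  case (rec_S g h n)
  show ?case
    using eventually_gt_at_top[of n] by eventually_elim (simp add: ap_rec_tok)
next
  case (app t t' u)
  from app.IH show ?case by eventually_elim simp
qed

lemma sound_unary:
  assumes "\<And>K \<rho>. models K \<rho> \<Gamma> \<Longrightarrow> Num 1 \<in> den K p \<rho> \<Longrightarrow> Num 1 \<in> den K c \<rho>"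
  shows "\<forall>\<^sub>F K in sequentially. (\<forall>P \<in> set [\<Gamma> \<turnstile> p]. valid K P) \<longrightarrow> valid K (\<Gamma> \<turnstile> c)"
  by (intro always_eventually allI impI) (use assms in simp)

text \<open>Only the conversion rules ask for a large \<open>K\<close>, through
  \<open>head_step_sound\<close>; the other rules preserve validity in each single model.\<close>

lemma rga_rule_sound:
  assumes "rga_rule Ps J"
  shows "\<forall>\<^sub>F K in sequentially. (\<forall>P \<in> set Ps. valid K P) \<longrightarrow> valid K J"
  using assms
proof cases
  case (conv_exp c c' \<Gamma>)
  from head_step_sound[OF conv_exp(3)] show ?thesis
    unfolding conv_exp by eventually_elim simp
next
  case (conv_red c c' \<Gamma>)
  from head_step_sound[OF conv_red(3)] show ?thesis
    unfolding conv_red by eventually_elim simp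
next
  case (conv_neg c c' \<Gamma>)
  from head_step_sound[OF conv_neg(3)] show ?thesis
    unfolding conv_neg by eventually_elim (simp add: holds_simps)
next
  case (conv_eq c c' \<Gamma>)
  from head_step_sound[OF conv_eq(3)] show ?thesis
    unfolding conv_eq by eventually_elim (simp add: holds_simps)
next
  case (eq_subst \<Gamma> a b i p)
  show ?thesis
    unfolding eq_subst
  proof (intro always_eventually allI impI)
    fix K
    assume *: "\<forall>P \<in> set [\<Gamma> \<turnstile> a \<^bold>= b, \<Gamma> \<turnstile> [i \<^bold>\<mapsto> a] p]. valid K P"
    \<comment> \<open>A common number determines both denotations completely, so \<open>a\<close>
      and \<open>b\<close> are interchangeable in \<open>p\<close>.\<close>
    have "den K a \<rho> = den K b \<rho>" if "models K \<rho> \<Gamma>" for \<rho>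
    proof -
      have "\<exists>n. Num n \<in> den K a \<rho> \<and> Num n \<in> den K b \<rho>"
        using * that by (simp add: holds_Eq)
      then show ?thesis
        using models_den_eq_Num[OF that] by metis
    qed
    with * show "valid K (\<Gamma> \<turnstile> [i \<^bold>\<mapsto> b] p)"
      by (simp add: den_subst)
  qed
next
  case (induction \<Gamma> i c a)
  show ?thesis
    unfolding induction(1,2)
  proof (intro always_eventually allI impI)
    fix K
    assume *: "\<forall>P \<in> set [\<Gamma> \<turnstile> [i \<^bold>\<mapsto> Zero] c, \<Gamma> \<^bold>, c \<^bold>, (Var i) \<^bold>N \<turnstile> [i \<^bold>\<mapsto> Succ (Var i)] c, \<Gamma> \<turnstile> a \<^bold>N].
      valid K P"
    have "Num 1 \<in> den K c (\<rho>(i := den K a \<rho>))" if \<rho>: "models K \<rho> \<Gamma>" for \<rho>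
    proof -
      \<comment> \<open>The induction runs over actual numbers as values of the variable; the
        denotation of \<open>a\<close> is exactly one such singleton.\<close>
      have "Num 1 \<in> den K c (\<rho>(i := {Num n}))" for n
      proof (induction n)
        case 0
        show ?case
          using * \<rho> by (simp add: den_subst del: fun_upd_apply)
      next
        case (Suc n)
        have "models K (\<rho>(i := {Num n})) \<Gamma>"
          using \<rho> induction(3) by (intro models_fresh) auto
        with Suc have "models K (\<rho>(i := {Num n})) (\<Gamma> \<^bold>, c \<^bold>, (Var i) \<^bold>N)"
          by (simp add: models_insert holds_Eq del: fun_upd_apply) simp
        with * have "Num 1 \<in> den K ([i \<^bold>\<mapsto> Succ (Var i)] c) (\<rho>(i := {Num n}))"
          by simp
        moreover have "den K (Succ (Var i)) (\<rho>(i := {Num n})) = {Num (Suc n)}"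
          by auto
        ultimately show ?case
          by (simp only: den_subst fun_upd_upd)
      qed
      moreover have "\<exists>n. Num n \<in> den K a \<rho>"
        using * \<rho> by (simp add: holds_Eq)
      then have "\<exists>n. den K a \<rho> = {Num n}"
        using models_den_eq_Num[OF \<rho>] by blast
      ultimately show ?thesis by metis
    qed
    then show "valid K (\<Gamma> \<turnstile> [i \<^bold>\<mapsto> a] c)"
      by (simp add: den_subst)
  qed
next
  case (rec_eq \<Gamma> m h g)
  show ?thesis
    unfolding rec_eq
  proof (intro always_eventually allI impI)
    fix K
    assume *: "\<forall>P \<in> set [\<Gamma> \<turnstile> m \<^bold>N, \<Gamma> \<turnstile> (h \<cdot> m \<cdot> (Rec \<cdot> g \<cdot> h \<cdot> m)) \<^bold>N]. valid K P"
    have "Num 1 \<in> den K (Rec \<cdot> g \<cdot> h \<cdot> Succ m \<^bold>= h \<cdot> m \<cdot> (Rec \<cdot> g \<cdot> h \<cdot> m)) \<rho>"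
      if \<rho>: "models K \<rho> \<Gamma>" for \<rho>
    proof -
      have "\<exists>k. Num k \<in> den K m \<rho>" "\<exists>l. Num l \<in> den K (h \<cdot> m \<cdot> (Rec \<cdot> g \<cdot> h \<cdot> m)) \<rho>"
        using * \<rho> by (simp_all add: holds_Eq)
      then obtain k l where "Num k \<in> den K m \<rho>"
        and l: "Num l \<in> den K (h \<cdot> m \<cdot> (Rec \<cdot> g \<cdot> h \<cdot> m)) \<rho>"
        by blast
      then have "den K m \<rho> = {Num k}"
        using models_den_eq_Num[OF \<rho>] by blast
      \<comment> \<open>The unfolded value contains a number by the second premise. That number
        survives the intersection with \<open>range Num\<close>, so the equation holds beyond
        \<open>K\<close> as well.\<close>
      with l show ?thesis
        by (auto simp: holds_Eq ap_rec_tok)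
    qed
    then show "valid K (\<Gamma> \<turnstile> Rec \<cdot> g \<cdot> h \<cdot> Succ m \<^bold>= h \<cdot> m \<cdot> (Rec \<cdot> g \<cdot> h \<cdot> m))"
      by simp
  qed
next
  case (univI \<Gamma> f)
  show ?thesis
    unfolding univI
  proof (intro always_eventually allI impI)
    fix K
    assume *: "\<forall>P \<in> set [fimage (shift 0) \<Gamma> \<^bold>, (Var 0) \<^bold>N \<turnstile> \<up> f \<cdot> Var 0]. valid K P"
    have "Num 1 \<in> ap (den K f \<rho>) {Num n}" if "models K \<rho> \<Gamma>" for \<rho> n
      using * models_up[OF that, of n] by (auto simp: den_up)
    then show "valid K (\<Gamma> \<turnstile> Univ \<cdot> f)"
      by (simp add: Num_1_univ)
  qed
next
  case (neg_univE \<Gamma> f c)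
  show ?thesis
    unfolding neg_univE
  proof (intro always_eventually allI impI)
    fix K
    assume *: "\<forall>P \<in> set [\<Gamma> \<turnstile> \<^bold>\<not> (Univ \<cdot> f),
      fimage (shift 0) \<Gamma> \<^bold>, \<^bold>\<not> (\<up> f \<cdot> Var 0) \<^bold>, (Var 0) \<^bold>N \<turnstile> \<up> c]. valid K P"
    have "Num 1 \<in> den K c \<rho>" if \<rho>: "models K \<rho> \<Gamma>" for \<rho>
    proof -
      have "\<exists>n. Num 0 \<in> ap (den K f \<rho>) {Num n}"
        using * \<rho> by (simp add: holds_Neg Num_0_univ)
      then obtain n where "Num 0 \<in> ap (den K f \<rho>) {Num n}"
        by blast
      \<comment> \<open>The number at which \<open>f\<close> fails becomes the value of the fresh
        variable; the shifted \<open>c\<close> does not depend on it.\<close>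
      then have "models K (case_nat {Num n} \<rho>)
          (fimage (shift 0) \<Gamma> \<^bold>, \<^bold>\<not> (\<up> f \<cdot> Var 0) \<^bold>, (Var 0) \<^bold>N)"
        using models_up[OF \<rho>, of n] by (simp add: models_insert holds_Neg den_up)
      with * have "Num 1 \<in> den K (\<up> c) (case_nat {Num n} \<rho>)"
        by simp
      then show ?thesis
        by (simp add: den_up)
    qed
    then show "valid K (\<Gamma> \<turnstile> c)"
      by simp
  qed
next
  case (univE \<Gamma> f a)
  show ?thesis
    unfolding univE
  proof (intro always_eventually allI impI)
    fix K
    assume *: "\<forall>P \<in> set [\<Gamma> \<turnstile> Univ \<cdot> f, \<Gamma> \<turnstile> a \<^bold>N]. valid K P"
    have "Num 1 \<in> den K (f \<cdot> a) \<rho>" if \<rho>: "models K \<rho> \<Gamma>" for \<rho>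
    proof -
      have "\<forall>n. Num 1 \<in> ap (den K f \<rho>) {Num n}" "\<exists>n. Num n \<in> den K a \<rho>"
        using * \<rho> by (simp_all add: holds_Eq Num_1_univ)
      then show ?thesis
        using models_den_eq_Num[OF \<rho>] by fastforce
    qed
    then show "valid K (\<Gamma> \<turnstile> f \<cdot> a)"
      by simp
  qed
next
  case (neg_univI \<Gamma> f a)
  show ?thesis
    unfolding neg_univI
  proof (intro always_eventually allI impI)
    fix K
    assume *: "\<forall>P \<in> set [\<Gamma> \<turnstile> \<^bold>\<not> (f \<cdot> a), \<Gamma> \<turnstile> a \<^bold>N]. valid K P"
    have "Num 1 \<in> den K (\<^bold>\<not> (Univ \<cdot> f)) \<rho>" if \<rho>: "models K \<rho> \<Gamma>" for \<rho>
    proof -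
      have "Num 0 \<in> ap (den K f \<rho>) (den K a \<rho>)" "\<exists>n. Num n \<in> den K a \<rho>"
        using * \<rho> by (simp_all add: holds_Eq holds_Neg)
      then have "\<exists>n. Num 0 \<in> ap (den K f \<rho>) {Num n}"
        using models_den_eq_Num[OF \<rho>] by metis
      then show ?thesis
        by (simp add: holds_Neg Num_0_univ)
    qed
    then show "valid K (\<Gamma> \<turnstile> \<^bold>\<not> (Univ \<cdot> f))"
      by simp
  qed
next
  case (subst \<Gamma> c i s)
  show ?thesis
    unfolding subst by (intro always_eventually allI impI) (simp add: den_subst models_subst)
next
  case (negE \<Gamma> a c)
  show ?thesis
    unfolding negE using models_Num_unique[of _ _ \<Gamma> 0 a 1]
    by (intro always_eventually allI impI) (simp add: holds_Neg, metis zero_neq_one)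
next
  case (orE \<Gamma> a b c)
  show ?thesis
    unfolding orE by (intro always_eventually allI impI) (simp add: holds_Or models_insert, blast)
next
  case (zero_nat \<Gamma>)
  show ?thesis
    unfolding zero_nat by (simp add: holds_Eq)
next
  case (eq_boolI \<Gamma> a b)
  show ?thesis
    unfolding eq_boolI
    by (intro always_eventually allI impI) (simp add: holds_simps, metis)
next
  case (nat_eqD \<Gamma> a)
  show ?thesis
    unfolding nat_eqD by (rule sound_unary)
next
  case (nat_eqI \<Gamma> a)
  show ?thesis
    unfolding nat_eqI by (rule sound_unary)
next
  case (eq_sym \<Gamma> a b)
  show ?thesis
    unfolding eq_sym by (rule sound_unary) (auto simp: holds_simps)
next
  case (neq_sym \<Gamma> a b)
  show ?thesis
    unfolding neq_sym by (rule sound_unary) (simp add: holds_simps, metis)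
next
  case (eq_boolE \<Gamma> a b)
  show ?thesis
    unfolding eq_boolE by (rule sound_unary) (auto simp: holds_simps)
next
  case (succ_natI \<Gamma> a)
  show ?thesis
    unfolding succ_natI by (rule sound_unary) (auto simp: holds_simps)
next
  case (succ_natE \<Gamma> a)
  show ?thesis
    unfolding succ_natE by (rule sound_unary) (auto simp: holds_simps)
next
  case (succ_neq_zero \<Gamma> a)
  show ?thesis
    unfolding succ_neq_zero by (rule sound_unary) (auto simp: holds_simps)
next
  case (succ_neqI \<Gamma> a b)
  show ?thesis
    unfolding succ_neqI by (rule sound_unary) (simp add: holds_Neg fails_Eq_Succ)
next
  case (succ_neqE \<Gamma> a b)
  show ?thesis
    unfolding succ_neqE by (rule sound_unary) (simp add: holds_Neg fails_Eq_Succ)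
next
  case (succ_inj \<Gamma> a b)
  show ?thesis
    unfolding succ_inj by (rule sound_unary) (auto simp: holds_simps)
next
  case (bot \<Gamma> p)
  show ?thesis
    unfolding bot by (rule sound_unary) (auto simp: holds_simps)
qed (simp add: models_insert holds_simps always_eventually; blast)+

text \<open>ATI is sound in every model: if \<open>u\<close> has a truth value at each number, then
  either all are true or one is false, and \<open>univ_tok\<close> has a value in both
  cases.\<close>

lemma oga_rule_sound:
  assumes "oga_rule Ps J"
  shows "\<forall>\<^sub>F K in sequentially. (\<forall>P \<in> set Ps. valid K P) \<longrightarrow> valid K J"
  using assms
proof cases
  case rga
  then show ?thesis by (rule rga_rule_sound)
next
  case (ati \<Gamma> u)
  show ?thesis
    unfolding ati
    by (auto intro!: always_eventually simp: Num_1_univ Num_0_univ holds_simps ap_Lam den_up)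
qed

text \<open>Strong induction along the proof: each entry has finitely many premises, so their bounds
  on \<open>K\<close> and that of the rule instance can be combined.\<close>

lemma oga_sound:
  assumes "derivable oga_rule J"
  shows "\<forall>\<^sub>F K in sequentially. valid K J"
proof -
  obtain Js where Js: "is_proof oga_rule Js" "J \<in> set Js"
    using assms by (auto simp: derivable_def)
  have "\<forall>\<^sub>F K in sequentially. valid K (Js ! k)" if "k < length Js" for k
    using that
  proof (induction k rule: less_induct)
    case (less k)
    then obtain Ps where Ps: "set Ps \<subseteq> set (take k Js)" "oga_rule Ps (Js ! k)"
      using Js(1) by (auto simp: is_proof_def)
    have "\<forall>\<^sub>F K in sequentially. valid K P" if "P \<in> set Ps" for P
    proof -
      from that Ps(1) have "P \<in> set (take k Js)"
        by blast
      then obtain j where "j < k" "P = Js ! j"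
        by (auto simp: in_set_conv_nth)
      with less show ?thesis by simp
    qed
    then have "\<forall>\<^sub>F K in sequentially. \<forall>P \<in> set Ps. valid K P"
      by (simp add: eventually_ball_finite)
    with oga_rule_sound[OF Ps(2)] show ?case
      by eventually_elim simp
  qed
  with Js(2) show ?thesis
    by (auto simp: in_set_conv_nth)
qed

section \<open>The incompleteness\<close>

text \<open>The proofs of the premises are concatenated and \<open>J\<close> is appended; every
  entry still finds its premises before it.\<close>

lemma derivable_step:
  assumes "R Ps J" and "\<And>P. P \<in> set Ps \<Longrightarrow> derivable R P"
  shows "derivable R J"
proof -
  have "\<exists>Js. is_proof R Js \<and> set Qs \<subseteq> set Js" if "set Qs \<subseteq> set Ps" for Qs
    using that
  proof (induction Qs)
    case Nil
    show ?case
      by (intro exI[of _ "[]"]) (simp add: is_proof_def)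
  next
    case (Cons Q Qs)
    then obtain Js where Js: "is_proof R Js" "set Qs \<subseteq> set Js"
      by auto
    obtain Js' where Js': "is_proof R Js'" "Q \<in> set Js'"
      using assms(2)[of Q] Cons.prems by (auto simp: derivable_def)
    have "is_proof R (Js @ Js')"
      unfolding is_proof_def
    proof (intro allI impI)
      fix k
      assume k: "k < length (Js @ Js')"
      show "\<exists>Ps. set Ps \<subseteq> set (take k (Js @ Js')) \<and> R Ps ((Js @ Js') ! k)"
      proof (cases "k < length Js")
        case True
        with Js(1) show ?thesis
          by (auto simp: is_proof_def nth_append)
      next
        case False
        with k have "k - length Js < length Js'" by auto
        with Js'(1) obtain Ps where
          "set Ps \<subseteq> set (take (k - length Js) Js')" "R Ps (Js' ! (k - length Js))"
          unfolding is_proof_def by blast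
        with False show ?thesis
          by (intro exI[of _ Ps]) (auto simp: nth_append)
      qed
    qed
    with Js(2) Js'(2) show ?case
      by (intro exI[of _ "Js @ Js'"]) auto
  qed
  then obtain Js where Js: "is_proof R Js" "set Ps \<subseteq> set Js"
    by blast
  have "is_proof R (Js @ [J])"
    unfolding is_proof_def
  proof (intro allI impI)
    fix k
    assume "k < length (Js @ [J])"
    then consider "k < length Js" | "k = length Js" by fastforce
    then show "\<exists>Ps. set Ps \<subseteq> set (take k (Js @ [J])) \<and> R Ps ((Js @ [J]) ! k)"
    proof cases
      case 1
      with Js(1) show ?thesis
        by (auto simp: is_proof_def nth_append)
    next
      case 2
      with Js(2) assms(1) show ?thesis by auto
    qed
  qed
  then show ?thesis
    unfolding derivable_def by (intro exI[of _ "Js @ [J]"]) simp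
qed

lemma derivable_rga_step1:
  "rga_rule [P] J \<Longrightarrow> derivable oga_rule P \<Longrightarrow> derivable oga_rule J"
  by (rule derivable_step[of oga_rule "[P]"]) (auto intro: oga_rule.rga)

lemma derivable_conv_exp:
  "c \<triangleright> c' \<Longrightarrow> derivable oga_rule (\<Gamma> \<turnstile> c') \<Longrightarrow> derivable oga_rule (\<Gamma> \<turnstile> c)"
  by (rule derivable_rga_step1[OF rga_rule.conv_exp])

text \<open>The base is the constant function 1, and the step function ignores the index and returns
  the previous stage. The values are functions, so the restricted recursion discards them.\<close>

definition const_rec :: "trm \<Rightarrow> trm" where
  "const_rec t = Rec \<cdot> Lam (numl 1) \<cdot> Lam (Lam (Var 0)) \<cdot> t"

text \<open>The induction on \<open>n\<close> is outside the calculus. Each successor is unfolded by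
  head steps in function position, which leave the trailing argument \<open>t\<close> in
  place.\<close>

lemma derivable_const_rec: "derivable oga_rule (\<Gamma> \<turnstile> const_rec (numl n) \<cdot> t)"
proof (induction n)
  case 0
  \<comment> \<open>The numeral 1 is derivable as a formula because it equals 1.\<close>
  have "derivable oga_rule (\<Gamma> \<turnstile> Zero \<^bold>= Zero)"
    by (rule derivable_step[of oga_rule "[]"]) (auto intro: oga_rule.rga rga_rule.zero_nat)
  then have "derivable oga_rule (\<Gamma> \<turnstile> numl 1 \<^bold>= numl 1)"
    unfolding One_nat_def numl_Suc numl_0 by (rule derivable_rga_step1[OF rga_rule.succ_natI])
  then have "derivable oga_rule (\<Gamma> \<turnstile> numl 1)"
    by (rule derivable_rga_step1[OF rga_rule.true_eqE])
  moreover have "Lam (numl 1) \<cdot> t \<triangleright> numl 1"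
    using head_step.beta[of "numl 1" t] by (simp add: One_nat_def)
  moreover have "const_rec (numl 0) \<cdot> t \<triangleright> Lam (numl 1) \<cdot> t"
    unfolding const_rec_def numl_0 by (intro head_step.intros)
  ultimately show ?case
    by (blast intro: derivable_conv_exp)
next
  case (Suc n)
  let ?r = "const_rec (numl n)"
  have "const_rec (numl (Suc n)) \<cdot> t \<triangleright> Lam (Lam (Var 0)) \<cdot> numl n \<cdot> ?r \<cdot> t"
    unfolding const_rec_def numl_Suc by (intro head_step.intros)
  moreover have "Lam (Lam (Var 0)) \<cdot> numl n \<cdot> ?r \<cdot> t \<triangleright> Lam (Var 0) \<cdot> ?r \<cdot> t"
    using head_step.beta[of "Lam (Var 0)" "numl n"] by (auto intro: head_step.app)
  moreover have "Lam (Var 0) \<cdot> ?r \<cdot> t \<triangleright> ?r \<cdot> t"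
    using head_step.beta[of "Var 0" ?r] by (auto intro: head_step.app)
  ultimately show ?case
    using Suc.IH by (blast intro: derivable_conv_exp)
qed

text \<open>The last step has index \<open>K\<close>, which is not below \<open>K\<close>, so only
  number tokens can remain, and a number applied to anything yields nothing.\<close>

lemma const_rec_undefined:
  assumes "den K t \<rho> = {Num (Suc K)}"
  shows "den K (const_rec t \<cdot> s) \<rho> = {}"
proof -
  have "den K (const_rec t) \<rho> \<subseteq> range Num"
    using assms by (auto simp: const_rec_def ap_rec_tok)
  then show ?thesis
    by (auto simp: ap_def)
qed

theorem theorem6p4:
  "\<exists>u. fv u = {} \<and>
     (\<forall>n. derivable oga_rule ({||} \<turnstile> u \<cdot> numl n)) \<and>
     \<not> derivable oga_rule ({||} \<turnstile> Univ \<cdot> u)"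
proof (intro exI conjI allI notI)
  \<comment> \<open>The recursion yields a function; applying it to \<open>Zero\<close> turns it
    into the truth value 1.\<close>
  let ?u = "Lam (const_rec (Var 0) \<cdot> Zero)"
  show "fv ?u = {}"
    by (auto simp: const_rec_def One_nat_def)
  show "derivable oga_rule ({||} \<turnstile> ?u \<cdot> numl n)" for n
  proof -
    have "?u \<cdot> numl n \<triangleright> const_rec (numl n) \<cdot> Zero"
      using head_step.beta[of "const_rec (Var 0) \<cdot> Zero" "numl n"]
      by (simp add: const_rec_def One_nat_def)
    then show ?thesis
      using derivable_const_rec by (rule derivable_conv_exp)
  qed
  assume "derivable oga_rule ({||} \<turnstile> Univ \<cdot> ?u)"
  then have "\<forall>\<^sub>F K in sequentially. valid K ({||} \<turnstile> Univ \<cdot> ?u)"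
    by (rule oga_sound)
  then obtain K where "valid K ({||} \<turnstile> Univ \<cdot> ?u)"
    using eventually_happens'[OF sequentially_bot] by blast
  moreover have "models K (\<lambda>_. {}) {||}"
    by (simp add: models_def coherent_def)
  \<comment> \<open>Truth of the quantified formula demands the value 1 at all numbers;
    \<open>Suc K\<close> is the first at which the recursion has lost its function.\<close>
  ultimately have "Num 1 \<in> ap (den K ?u (\<lambda>_. {})) {Num (Suc K)}"
    by (simp add: Num_1_univ)
  also have "\<dots> = {}"
    unfolding ap_Lam by (rule const_rec_undefined) simp
  finally show False
    by simp
qed

end
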